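(* (i) For every integer $n\geq 3$ there is a planar integral point set $M$ of $n$ points containing points $M_1,M_2$ with $|M_1M_2|=1$; this set consists of $n-1$ points, including $M_1$ and $M_2$, on a straight line and one point off that line. (ii) Conversely, if $M$ is a planar integral point set of $n$ points such that $|M_1M_2|=1$ for some $M_1,M_2\in M$, then $M$ consists of $n-1$ points, including $M_1$ and $M_2$, on a straight line, and one point off this line lying on the perpendicular bisector of the segment $M_1M_2$. Moreover, there is exactly one maximal planar integral point set $M'\supseteq M$, and this perpendicular bisector is an axis of symmetry of $M'$. Finally, if $n>3$, then the distance $1$ occurs in $M$ (and in $M'$) exactly once, i.e. $\{M_1,M_2\}$ is the only pair of points at distance $1$.
   Context: A planar integral point set is a finite set $M\subset\mathbb{R}^2$ such that all pairwise Euclidean distances between points of $M$ are integers and $M$ is not contained in a line. A planar integral point set $M$ of $n$ points is maximal if there is no planar integral point set $M'$ of $n+1$ points with $M\subsetneq M'$. *)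

theory Defs
  imports "HOL-Analysis.Analysis"
begin

definition planar_integral_point_set :: "(real ^ 2) set \<Rightarrow> bool" where
  "planar_integral_point_set M \<longleftrightarrow>
     finite M \<and> (\<forall>x\<in>M. \<forall>y\<in>M. dist x y \<in> \<int>) \<and> \<not> collinear M"

definition maximal_planar_integral_point_set :: "(real ^ 2) set \<Rightarrow> bool" where
  "maximal_planar_integral_point_set M \<longleftrightarrow>
     planar_integral_point_set M \<and>
     \<not> (\<exists>M'. planar_integral_point_set M' \<and> card M' = card M + 1 \<and> M \<subset> M')"

definition straight_line :: "(real ^ 2) set \<Rightarrow> bool" where
  "straight_line L \<longleftrightarrow> affine L \<and> aff_dim L = 1"

(* The line through the midpoint of the segment AB orthogonal to AB; meaningful for A \<noteq> B. *)
definition perpendicular_bisector :: "real ^ 2 \<Rightarrow> real ^ 2 \<Rightarrow> (real ^ 2) set" where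
  "perpendicular_bisector A B = {x. (x - midpoint A B) \<bullet> (B - A) = 0}"

(* For a line L, closest_point L is the orthogonal projection onto L. *)
definition reflection_across :: "(real ^ 2) set \<Rightarrow> real ^ 2 \<Rightarrow> real ^ 2" where
  "reflection_across L x = 2 *\<^sub>R closest_point L x - x"

definition axis_of_symmetry :: "(real ^ 2) set \<Rightarrow> (real ^ 2) set \<Rightarrow> bool" where
  "axis_of_symmetry L S \<longleftrightarrow> straight_line L \<and> reflection_across L ` S = S"

end

theory Submission
  imports Defs
begin

text \<open>Let \<open>AB\<close> have length 1. Integral distances from a point to \<open>A\<close> and \<open>B\<close> differ by at most 1, so
  the point lies on the line \<open>AB\<close> (at half-odd distance from the midpoint) or on the perpendicular
  bisector. Irrationality of the heights allows only one point \<open>P\<close> off the line, and then the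
  points with integral distances to \<open>A\<close>, \<open>B\<close> and \<open>P\<close> automatically form a finite integral
  point set, symmetric by construction; this is the unique maximal one. Large sets arise because its
  points on the line correspond to the divisors of \<open>4 a\<^sup>2 - 1\<close>, where \<open>a\<close> is the
  distance from \<open>P\<close> to \<open>A\<close>.\<close>

section \<open>Preliminaries: lines, residues modulo 4, subsets of integral point sets\<close>

lemma straight_line_hyperplane:
  fixes a :: "real ^ 2"
  assumes "a \<noteq> 0"
  shows "straight_line {x. a \<bullet> x = b}"
  using assms by (simp add: straight_line_def affine_hyperplane)

text \<open>Squares are 0 or 1 modulo 4. This is the source of the irrationality of the square root
  of \<open>4 * a\<^sup>2 - 1\<close>.\<close>

lemma not_square_mod_4:
  fixes m :: int
  shows "m\<^sup>2 \<noteq> 4 * a - 1"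
proof
  assume *: "m\<^sup>2 = 4 * a - 1"
  show False
  proof (cases "even m")
    case True
    then obtain k where "m = 2 * k" by blast
    with * have "4 * k\<^sup>2 = 4 * a - 1" by (simp add: power2_eq_square)
    then show False by presburger
  next
    case False
    then obtain k where "m = 2 * k + 1" by (elim oddE)
    with * have "4 * (k\<^sup>2 + k) + 1 = 4 * a - 1" by (simp add: power2_eq_square algebra_simps)
    then show False by presburger
  qed
qed

text \<open>One factor must be 1 and the other 3 modulo 4. This will make \<open>(u + v) / 4\<close>
  an integral distance.\<close>

lemma four_dvd_add_if_mult_mod_4:
  fixes u v :: int
  assumes "(u * v) mod 4 = 3"
  shows "4 dvd u + v"
proof -
  have "((u mod 4) * (v mod 4)) mod 4 = 3" using assms by (simp add: mod_mult_eq)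
  moreover have "u mod 4 \<in> {0,1,2,3}" "v mod 4 \<in> {0,1,2,3}" by auto
  ultimately have "((u mod 4) + (v mod 4)) mod 4 = 0" by auto
  then show ?thesis by (simp add: mod_add_eq dvd_eq_mod_eq_0)
qed

lemma planar_integral_point_set_subset:
  assumes "planar_integral_point_set M" "N \<subseteq> M" "\<not> collinear N"
  shows "planar_integral_point_set N"
  using assms unfolding planar_integral_point_set_def by (meson finite_subset subsetD)

text \<open>The lower set supplies non-collinearity, the upper one finiteness and integral
  distances.\<close>

lemma planar_integral_point_set_between:
  assumes "planar_integral_point_set M" "planar_integral_point_set K" "M \<subseteq> N" "N \<subseteq> K"
  shows "planar_integral_point_set N"
  using assms collinear_subset planar_integral_point_set_def planar_integral_point_set_subset
  by metis

section \<open>Cartesian coordinates adapted to a segment of length 1\<close>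

locale unit_segment =
  fixes A B :: "real ^ 2"
  assumes dist_1: "dist A B = 1"
begin

text \<open>The unit vector \<open>B - A\<close> turned by a right angle; the two form the
  orthonormal basis for \<open>along\<close> and \<open>height\<close>, with the midpoint as
  origin.\<close>

definition normal :: "real ^ 2" where
  "normal = vector [- ((B - A) $ 2), (B - A) $ 1]"

definition along :: "real ^ 2 \<Rightarrow> real" where
  "along Q = (Q - midpoint A B) \<bullet> (B - A)"

definition height :: "real ^ 2 \<Rightarrow> real" where
  "height Q = (Q - midpoint A B) \<bullet> normal"

definition base_line :: "(real ^ 2) set" where
  "base_line = {Q. height Q = 0}"

text \<open>Only distances to three points are restricted; integrality among the members is a
  consequence when \<open>P\<close> is off the line and itself at integral distances from
  \<open>A\<close> and \<open>B\<close>.\<close>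

definition integral_hull :: "real ^ 2 \<Rightarrow> (real ^ 2) set" where
  "integral_hull P = {Q. dist Q A \<in> \<int> \<and> dist Q B \<in> \<int> \<and> dist Q P \<in> \<int>}"

lemma unit_sq: "((B - A) $ 1)\<^sup>2 + ((B - A) $ 2)\<^sup>2 = 1"
proof -
  have "(norm (B - A))\<^sup>2 = 1" using dist_1 by (simp add: dist_norm norm_minus_commute)
  then show ?thesis
    unfolding power2_norm_eq_inner by (simp add: inner_vec_def sum_2 power2_eq_square)
qed

lemma dist_sq: "(dist P Q)\<^sup>2 = (along P - along Q)\<^sup>2 + (height P - height Q)\<^sup>2"
proof -
  define d e where "d = P - Q" and "e = B - A"
  have a: "along P - along Q = d $ 1 * e $ 1 + d $ 2 * e $ 2"
    by (simp add: along_def d_def e_def inner_diff_left[symmetric] inner_vec_def sum_2 algebra_simps)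
  have h: "height P - height Q = - (d $ 1 * e $ 2) + d $ 2 * e $ 1"
    by (simp add: height_def normal_def d_def e_def inner_vec_def sum_2 algebra_simps)
  \<comment> \<open>The factor belonging to \<open>e\<close> is 1; it is inserted so that the
    two-square identity can be applied.\<close>
  have "(dist P Q)\<^sup>2 = ((d $ 1)\<^sup>2 + (d $ 2)\<^sup>2) * ((e $ 1)\<^sup>2 + (e $ 2)\<^sup>2)"
    using unit_sq unfolding dist_norm power2_norm_eq_inner d_def[symmetric] e_def[symmetric]
    by (simp add: inner_vec_def sum_2 power2_eq_square)
  also have "\<dots> = (along P - along Q)\<^sup>2 + (height P - height Q)\<^sup>2"
    unfolding a h by (simp add: power2_eq_square algebra_simps)
  finally show ?thesis .
qed

lemma dist_eq: "dist P Q = sqrt ((along P - along Q)\<^sup>2 + (height P - height Q)\<^sup>2)"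
  by (metis dist_sq real_sqrt_abs abs_of_nonneg zero_le_dist)

lemma point_eqI: "along P = along Q \<Longrightarrow> height P = height Q \<Longrightarrow> P = Q"
  using dist_sq[of P Q] by simp

lemma along_plus: "along (Q + r *\<^sub>R (B - A) + h *\<^sub>R normal) = along Q + r"
  and height_plus: "height (Q + r *\<^sub>R (B - A) + h *\<^sub>R normal) = height Q + h"
proof -
  have "(B - A) \<bullet> (B - A) = 1" "normal \<bullet> normal = 1" "normal \<bullet> (B - A) = 0" "(B - A) \<bullet> normal = 0"
    using unit_sq by (simp_all add: normal_def inner_vec_def sum_2 power2_eq_square algebra_simps)
  moreover have eq: "Q + r *\<^sub>R (B - A) + h *\<^sub>R normal - midpoint A B
      = (Q - midpoint A B) + r *\<^sub>R (B - A) + h *\<^sub>R normal" by simp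
  ultimately show "along (Q + r *\<^sub>R (B - A) + h *\<^sub>R normal) = along Q + r"
    "height (Q + r *\<^sub>R (B - A) + h *\<^sub>R normal) = height Q + h"
    unfolding along_def height_def eq by (simp_all add: inner_add_left)
qed

lemma midpoint_coords: "along (midpoint A B) = 0" "height (midpoint A B) = 0"
  by (simp_all add: along_def height_def)

lemma end_eqs: "A = midpoint A B + (- 1/2) *\<^sub>R (B - A) + 0 *\<^sub>R normal"
  "B = midpoint A B + (1/2) *\<^sub>R (B - A) + 0 *\<^sub>R normal"
  by (simp_all add: midpoint_def vec_eq_iff field_simps)

lemma along_ends [simp]: "along A = - 1/2" "along B = 1/2"
  using along_plus[of "midpoint A B" "- 1/2" 0] along_plus[of "midpoint A B" "1/2" 0]
  by (simp_all only: end_eqs[symmetric] midpoint_coords add_0)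

lemma height_ends [simp]: "height A = 0" "height B = 0"
  using height_plus[of "midpoint A B" "- 1/2" 0] height_plus[of "midpoint A B" "1/2" 0]
  by (simp_all only: end_eqs[symmetric] midpoint_coords add_0)

lemma point_exists: obtains Q where "along Q = r" "height Q = h"
  using along_plus[of "midpoint A B" r h] height_plus[of "midpoint A B" r h]
  by (auto simp: midpoint_coords)

lemma straight_line_base_line: "straight_line base_line"
proof -
  have "normal \<noteq> 0"
    using unit_sq by (auto simp: normal_def vec_eq_iff forall_2)
  moreover have "base_line = {Q. normal \<bullet> Q = normal \<bullet> midpoint A B}"
    by (auto simp: base_line_def height_def inner_diff_left inner_commute[of normal])
  ultimately show ?thesis using straight_line_hyperplane by simp
qed

lemma collinear_base_line: "collinear base_line"
  using straight_line_base_line by (simp add: straight_line_def collinear_aff_dim)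

lemma perpendicular_bisector_eq: "perpendicular_bisector A B = {Q. along Q = 0}"
  by (simp add: perpendicular_bisector_def along_def)

lemma perpendicular_bisector_hyperplane:
  "perpendicular_bisector A B = {Q. (B - A) \<bullet> Q = (B - A) \<bullet> midpoint A B}"
proof -
  have "(Q - midpoint A B) \<bullet> (B - A) = (B - A) \<bullet> Q - (B - A) \<bullet> midpoint A B" for Q
    by (metis inner_commute inner_diff_right)
  then show ?thesis by (simp add: perpendicular_bisector_def)
qed

lemma straight_line_perpendicular_bisector: "straight_line (perpendicular_bisector A B)"
proof -
  have "B - A \<noteq> 0" using dist_1 by auto
  then show ?thesis unfolding perpendicular_bisector_hyperplane by (rule straight_line_hyperplane)
qed

text \<open>A line through \<open>A\<close> and \<open>B\<close> can only be the base line. Hence a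
  point of nonzero height certifies non-collinearity.\<close>

lemma collinear_height:
  assumes "collinear M" "A \<in> M" "B \<in> M" "Q \<in> M"
  shows "height Q = 0"
proof -
  have "A \<noteq> B" using dist_1 by auto
  moreover have "collinear {A, B, Q}" using assms collinear_subset[of M "{A, B, Q}"] by simp
  ultimately have "Q \<in> affine hull {A, B}" using collinear_3_affine_hull by blast
  moreover have "affine hull {A, B} \<subseteq> base_line"
    using straight_line_base_line by (intro hull_minimal) (auto simp: straight_line_def base_line_def)
  ultimately show ?thesis by (auto simp: base_line_def)
qed

lemma reflection_coords:
  "along (reflection_across (perpendicular_bisector A B) Q) = - along Q" (is ?th1)
  "height (reflection_across (perpendicular_bisector A B) Q) = height Q" (is ?th2)
proof -
  let ?L = "perpendicular_bisector A B"
  have shift: "along (Q + r *\<^sub>R (B - A)) = along Q + r"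
    "height (Q + r *\<^sub>R (B - A)) = height Q" for r
    using along_plus[of Q r 0] height_plus[of Q r 0] by simp_all
  \<comment> \<open>The foot of the perpendicular from \<open>Q\<close>, recognised as the closest
    point because the bisector is closed and convex.\<close>
  define R where "R = Q + (- along Q) *\<^sub>R (B - A)"
  have R: "along R = 0" "height R = height Q"
    unfolding R_def shift by simp_all
  have "closed ?L" "convex ?L"
    by (simp_all add: perpendicular_bisector_hyperplane closed_hyperplane convex_hyperplane)
  moreover have "R \<in> ?L" using R by (simp add: perpendicular_bisector_eq)
  moreover have "dist Q R \<le> dist Q z" if "z \<in> ?L" for z
    using that R by (simp add: dist_eq perpendicular_bisector_eq)
  ultimately have "closest_point ?L Q = R" using closest_point_unique by metis
  then have "reflection_across ?L Q = Q + (- 2 * along Q) *\<^sub>R (B - A)"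
    by (simp add: reflection_across_def \<open>closest_point ?L Q = R\<close> R_def vec_eq_iff algebra_simps)
  then show ?th1 ?th2 by (simp_all only: shift)
qed

text \<open>By the triangle inequality the integers \<^term>\<open>dist Q A\<close> and \<^term>\<open>dist Q B\<close> differ by at
  most 1; difference 1 is the equality case.\<close>
lemma integral_cases:
  assumes "dist Q A \<in> \<int>" "dist Q B \<in> \<int>"
  obtains "height Q = 0" "along Q - 1/2 \<in> \<int>"
  | "along Q = 0" "height Q \<noteq> 0"
proof -
  obtain a b where a: "dist Q A = of_int a" and b: "dist Q B = of_int b"
    using assms by (auto elim!: Ints_cases)
  have "\<bar>dist Q A - dist Q B\<bar> \<le> 1"
    using dist_triangle[of Q A B] dist_triangle[of Q B A] dist_1 by (simp add: dist_commute)
  then have "\<bar>a - b\<bar> \<le> 1" unfolding a b by linarith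
  then consider "a = b" | "a = b + 1" | "b = a + 1" by linarith
  moreover have A: "(of_int a)\<^sup>2 = (along Q + 1/2)\<^sup>2 + (height Q)\<^sup>2"
    and B: "(of_int b)\<^sup>2 = (along Q - 1/2)\<^sup>2 + (height Q)\<^sup>2"
    using dist_sq[of Q A] dist_sq[of Q B] by (simp_all add: a b)
  ultimately show ?thesis
  proof cases
    case 1
    then have "along Q = 0" using A B by (simp add: power2_eq_square algebra_simps)
    \<comment> \<open>Otherwise \<open>Q\<close> would be the midpoint, at the non-integral distance
      1/2 from \<open>A\<close>.\<close>
    moreover have "height Q \<noteq> 0"
    proof
      assume "height Q = 0"
      then have "(2 * of_int a)\<^sup>2 = (1::real)" using A \<open>along Q = 0\<close> by (simp add: power2_eq_square)
      then have "of_int ((2 * a)\<^sup>2) = (of_int 1 :: real)" by simp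
      then have "(2 * a)\<^sup>2 = 1" by linarith
      then show False by (simp add: power2_eq_square) presburger
    qed
    ultimately show ?thesis using that by blast
  next
    case 2
    \<comment> \<open>The difference of the two equations is
      \<open>a\<^sup>2 - b\<^sup>2 = 2 * along Q\<close>; the horizontal offset from
      \<open>B\<close> then already accounts for the whole distance \<open>b\<close>.\<close>
    then have t: "along Q = of_int b + 1/2" using A B by (simp add: power2_eq_square algebra_simps)
    then have "height Q = 0" using B by simp
    then show ?thesis using that t by simp
  next
    case 3
    then have t: "along Q = 1/2 - of_int b" using A B by (simp add: power2_eq_square algebra_simps)
    then have "height Q = 0" using B by simp
    then show ?thesis using that t by simp
  qed
qed

text \<open>Two such points would make their heights rational, and with them the square root of
  \<open>4 a\<^sup>2 - 1\<close>, where \<open>a\<close> is the distance to \<^term>\<open>A\<close>.\<close>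
lemma off_line_unique:
  assumes P: "dist P A \<in> \<int>" "along P = 0" and Q: "dist Q A \<in> \<int>" "along Q = 0"
    and "dist P Q \<in> \<int>"
  shows "P = Q"
proof (rule ccontr)
  assume "P \<noteq> Q"
  obtain a b where a: "dist P A = of_int a" and b: "dist Q A = of_int b"
    using assms by (auto elim!: Ints_cases)
  have A: "(of_int a)\<^sup>2 = 1/4 + (height P)\<^sup>2" and B: "(of_int b)\<^sup>2 = 1/4 + (height Q)\<^sup>2"
    using dist_sq[of P A] dist_sq[of Q A] by (simp_all add: a b P Q power2_eq_square)
  have "\<bar>height P - height Q\<bar> \<in> \<int>" using assms by (simp add: dist_eq)
  then have "height P - height Q \<in> \<int>" by (metis Ints_minus abs_if minus_minus)
  then obtain k where k: "height P - height Q = of_int k" by (auto elim!: Ints_cases)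
  have "k \<noteq> 0" using \<open>P \<noteq> Q\<close> point_eqI[of P Q] P Q k by auto
  \<comment> \<open>Subtracting the equations for \<open>a\<close> and \<open>b\<close> cancels the
    squared heights and leaves \<open>2 * height P * k = N\<close>, so the height is
    rational.\<close>
  define N where "N = k\<^sup>2 + a\<^sup>2 - b\<^sup>2"
  have q: "height Q = height P - of_int k" using k by simp
  have "2 * height P * of_int k = of_int N"
    unfolding N_def using A B by (simp add: q power2_eq_square algebra_simps)
  then have "(of_int N)\<^sup>2 = (2 * height P * of_int k)\<^sup>2" by simp
  also have "\<dots> = (of_int k)\<^sup>2 * (4 * (height P)\<^sup>2)" by (simp add: power_mult_distrib)
  also have "\<dots> = of_int (k\<^sup>2 * (4 * a\<^sup>2 - 1))" using A by simp
  finally have "of_int (N\<^sup>2) = (of_int (k\<^sup>2 * (4 * a\<^sup>2 - 1)) :: real)" by simp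
  then have N: "N\<^sup>2 = k\<^sup>2 * (4 * a\<^sup>2 - 1)" by (simp only: of_int_eq_iff)
  \<comment> \<open>Divisibility of the squares passes to the bases, so twice the height is an
    integer \<open>m\<close> whose square is 3 modulo 4.\<close>
  then have "k dvd N" by (metis dvd_triv_left pow_divides_pow_iff pos2)
  then obtain m where "N = k * m" by blast
  then have "m\<^sup>2 = 4 * a\<^sup>2 - 1" using N \<open>k \<noteq> 0\<close> by (simp add: power_mult_distrib)
  then show False using not_square_mod_4 by blast
qed

section \<open>The integral hull of an apex off the base line\<close>

context
  fixes P
  assumes PA: "dist P A \<in> \<int>" and PB: "dist P B \<in> \<int>" and P0: "height P \<noteq> 0"
begin

lemma along_apex: "along P = 0"
  using integral_cases[OF PA PB] P0 by blast

text \<open>A member off the line lies on the bisector, as \<open>P\<close> does, and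
  \<open>off_line_unique\<close> identifies the two.\<close>

lemma integral_hull_cases:
  assumes "Q \<in> integral_hull P"
  obtains "Q = P" | "height Q = 0" "along Q - 1/2 \<in> \<int>"
proof (rule integral_cases[of Q])
  show "dist Q A \<in> \<int>" "dist Q B \<in> \<int>" using assms by (auto simp: integral_hull_def)
next
  assume "along Q = 0" "height Q \<noteq> 0"
  then have "Q = P"
    using off_line_unique[of Q P] along_apex PA assms by (simp add: integral_hull_def)
  then show ?thesis using that by blast
qed (use that in blast)

lemma integral_hull_members: "A \<in> integral_hull P" "B \<in> integral_hull P" "P \<in> integral_hull P"
  using PA PB dist_1 by (simp_all add: integral_hull_def dist_commute)

lemma integral_hullI:
  assumes "height Q = 0" "along Q - 1/2 \<in> \<int>" "dist Q P \<in> \<int>"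
  shows "Q \<in> integral_hull P"
proof -
  obtain k where "along Q = of_int k + 1/2"
    using assms(2) by (metis Ints_cases diff_add_cancel)
  then have "dist Q A = of_int \<bar>k + 1\<bar>" "dist Q B = of_int \<bar>k\<bar>"
    using assms(1) by (simp_all add: dist_eq)
  then show ?thesis using assms(3) by (simp add: integral_hull_def del: of_int_abs)
qed

text \<open>For a point on the line, the integral distance to \<open>P\<close> exceeds the half-odd
  absolute abscissa by at least 1/2, while the squares differ by the fixed amount
  \<open>(height P)\<^sup>2\<close>. This bounds the abscissa.\<close>

lemma finite_integral_hull: "finite (integral_hull P)"
proof -
  define S where "S = integral_hull P - {P}"
  have S: "height Q = 0" "along Q - 1/2 \<in> \<int>" if "Q \<in> S" for Q
    using that integral_hull_cases[of Q] unfolding S_def by auto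
  have bound: "\<bar>along Q\<bar> \<le> (height P)\<^sup>2" if Q: "Q \<in> S" for Q
  proof -
    obtain k where k: "along Q = of_int k + 1/2"
      using S(2)[OF Q] by (metis Ints_cases diff_add_cancel)
    obtain c where c: "dist Q P = of_int c"
      using Q by (auto simp: S_def integral_hull_def elim!: Ints_cases)
    have sq: "(of_int c)\<^sup>2 = \<bar>along Q\<bar>\<^sup>2 + (height P)\<^sup>2"
      using dist_sq[of Q P] S(1)[OF Q] by (simp add: along_apex c)
    moreover have "(height P)\<^sup>2 > 0" using P0 by simp
    ultimately have "\<bar>along Q\<bar>\<^sup>2 < (of_int c)\<^sup>2" by linarith
    moreover have "of_int c \<ge> (0::real)" using c zero_le_dist by metis
    ultimately have "\<bar>along Q\<bar> < of_int c" using power_less_imp_less_base by blast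
    then have "of_int (2 * c) > (of_int \<bar>2 * k + 1\<bar> :: real)" unfolding k by simp
    \<comment> \<open>After doubling, both sides are integers, so the strict inequality gains
      1.\<close>
    then have "2 * c \<ge> \<bar>2 * k + 1\<bar> + 1" by linarith
    then have "of_int (2 * c) \<ge> (of_int (\<bar>2 * k + 1\<bar> + 1) :: real)" by linarith
    then have "of_int c \<ge> \<bar>along Q\<bar> + 1/2" unfolding k by simp
    then have "(\<bar>along Q\<bar> + 1/2)\<^sup>2 \<le> (of_int c)\<^sup>2" by (intro power_mono) auto
    then have "\<bar>along Q\<bar>\<^sup>2 + \<bar>along Q\<bar> + 1/4 \<le> (of_int c)\<^sup>2"
      by (simp add: power2_sum power2_eq_square algebra_simps)
    then show ?thesis using sq by linarith
  qed
  \<comment> \<open>The extra 1 absorbs the offset 1/2 between \<open>k\<close> and the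
    abscissa.\<close>
  define h where "h = \<lceil>(height P)\<^sup>2\<rceil> + 1"
  have "along ` S \<subseteq> (\<lambda>k. of_int k + 1/2) ` {- h..h}"
  proof
    fix x assume "x \<in> along ` S"
    then obtain Q where Q: "Q \<in> S" "x = along Q" by blast
    obtain k where k: "along Q = of_int k + 1/2"
      using S(2)[OF Q(1)] by (metis Ints_cases diff_add_cancel)
    have "\<bar>of_int k + 1/2\<bar> \<le> (height P)\<^sup>2" using bound[OF Q(1)] k by simp
    then have "k \<in> {- h..h}" unfolding h_def by (simp, linarith)
    then show "x \<in> (\<lambda>k. of_int k + 1/2) ` {- h..h}" using Q k by blast
  qed
  moreover have "inj_on along S" using S(1) by (intro inj_onI point_eqI) auto
  ultimately have "finite S" by (meson finite_atLeastAtMost_int finite_imageD finite_imageI finite_subset)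
  then show ?thesis by (simp add: S_def)
qed

text \<open>Half-odd abscissae on one line differ by integers, and distances to the only other
  member \<open>P\<close> are integral by definition.\<close>

lemma planar_integral_point_set_integral_hull: "planar_integral_point_set (integral_hull P)"
  unfolding planar_integral_point_set_def
proof (intro conjI ballI)
  show "finite (integral_hull P)" by (rule finite_integral_hull)
  show "\<not> collinear (integral_hull P)"
    using collinear_height[of "integral_hull P" P] integral_hull_members P0 by auto
  fix X Y assume X: "X \<in> integral_hull P" and Y: "Y \<in> integral_hull P"
  then have P: "dist X P \<in> \<int>" "dist Y P \<in> \<int>" by (auto simp: integral_hull_def)
  show "dist X Y \<in> \<int>"
  proof (cases "X = P \<or> Y = P")
    case True
    then show ?thesis using P by (auto simp: dist_commute)
  next
    case False
    then have "height X = 0" "along X - 1/2 \<in> \<int>" "height Y = 0" "along Y - 1/2 \<in> \<int>"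
      using integral_hull_cases X Y by blast+
    moreover from this have "(along X - 1/2) - (along Y - 1/2) \<in> \<int>" using Ints_diff by blast
    then have "\<bar>along X - along Y\<bar> \<in> \<int>" by (simp add: Ints_abs)
    ultimately show ?thesis by (simp add: dist_eq Ints_abs del: Ints_diff)
  qed
qed

lemma subset_integral_hull:
  assumes "planar_integral_point_set M" "A \<in> M" "B \<in> M" "P \<in> M"
  shows "M \<subseteq> integral_hull P"
  using assms by (auto simp: planar_integral_point_set_def integral_hull_def)

text \<open>The hull is itself an integral point set and contains every other one through
  \<open>A\<close>, \<open>B\<close> and \<open>P\<close>; existence and uniqueness of the maximal
  set both follow.\<close>

lemma maximal_planar_integral_point_set_iff:
  assumes M: "planar_integral_point_set M" "A \<in> M" "B \<in> M" "P \<in> M"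
  shows "maximal_planar_integral_point_set M' \<and> M \<subseteq> M' \<longleftrightarrow> M' = integral_hull P"
proof
  assume *: "maximal_planar_integral_point_set M' \<and> M \<subseteq> M'"
  then have M': "planar_integral_point_set M'" "M \<subseteq> M'"
    by (auto simp: maximal_planar_integral_point_set_def)
  then have sub: "M' \<subseteq> integral_hull P" using M by (intro subset_integral_hull) auto
  show "M' = integral_hull P"
  proof (rule ccontr)
    assume "M' \<noteq> integral_hull P"
    \<comment> \<open>Maximality only excludes enlargement by a single point, so exactly one missing
      point is added.\<close>
    then obtain X where X: "X \<in> integral_hull P" "X \<notin> M'" using sub by blast
    have "planar_integral_point_set (insert X M')"
      using planar_integral_point_set_between[OF M'(1) planar_integral_point_set_integral_hull] X sub
      by blast
    moreover have "card (insert X M') = card M' + 1" "M' \<subset> insert X M'"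
      using X M' by (auto simp: planar_integral_point_set_def)
    ultimately show False using * unfolding maximal_planar_integral_point_set_def by blast
  qed
next
  assume eq: "M' = integral_hull P"
  have "\<not> M' \<subset> N" if "planar_integral_point_set N" for N
    using subset_integral_hull[OF that] integral_hull_members eq by blast
  then show "maximal_planar_integral_point_set M' \<and> M \<subseteq> M'"
    using eq planar_integral_point_set_integral_hull subset_integral_hull[OF M]
    by (auto simp: maximal_planar_integral_point_set_def)
qed

text \<open>The reflection swaps the distances to \<open>A\<close> and \<open>B\<close> and fixes
  the one to \<open>P\<close>, which lies on the axis. Being an involution, it maps the hull onto
  itself.\<close>

lemma axis_of_symmetry_integral_hull:
  "axis_of_symmetry (perpendicular_bisector A B) (integral_hull P)"
proof -
  let ?r = "reflection_across (perpendicular_bisector A B)"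
  have inv: "?r (?r Q) = Q" for Q by (rule point_eqI) (simp_all add: reflection_coords)
  have "dist (?r Q) A = dist Q B" "dist (?r Q) B = dist Q A" "dist (?r Q) P = dist Q P" for Q
    by (simp_all add: dist_eq reflection_coords along_apex power2_eq_square algebra_simps)
  then have mem: "?r Q \<in> integral_hull P" if "Q \<in> integral_hull P" for Q
    using that by (simp add: integral_hull_def)
  then have "?r ` integral_hull P = integral_hull P"
    using inv by (metis image_eqI image_subsetI subsetI subset_antisym)
  then show ?thesis using straight_line_perpendicular_bisector by (simp add: axis_of_symmetry_def)
qed

end

section \<open>The single point off the base line in a given set\<close>

lemma apex_exists:
  assumes "planar_integral_point_set M" "A \<in> M" "B \<in> M"
  obtains P where "P \<in> M" "height P \<noteq> 0" "dist P A \<in> \<int>" "dist P B \<in> \<int>"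
proof -
  have "\<not> M \<subseteq> base_line"
    using assms collinear_subset[OF collinear_base_line] by (auto simp: planar_integral_point_set_def)
  then show ?thesis using that assms by (auto simp: base_line_def planar_integral_point_set_def)
qed

lemma off_line_singleton:
  assumes "planar_integral_point_set M" "A \<in> M" "B \<in> M" "P \<in> M" "height P \<noteq> 0"
  shows "M - base_line = {P}"
proof -
  have P: "dist P A \<in> \<int>" "dist P B \<in> \<int>" using assms by (auto simp: planar_integral_point_set_def)
  have "M \<subseteq> integral_hull P" using subset_integral_hull[OF P assms(5) assms(1-4)] .
  then show ?thesis using integral_hull_cases[OF P assms(5)] assms by (auto simp: base_line_def)
qed

section \<open>Sets of every size\<close>

text \<open>Choosing \<open>4 a\<^sup>2 - 1 = D = 9\<^sup>n (9\<^sup>n + 2)\<close> for the distance \<open>a\<close> of the apex to the ends,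
  each factorisation \<open>D = u v\<close>, here with \<open>u = 3\<^sup>i\<close>, yields the point of the line with abscissa \<open>(v - u) / 4\<close>,
  at distance \<open>(u + v) / 4\<close> from the apex.\<close>
lemma large_integral_hull:
  obtains P where "dist P A \<in> \<int>" "dist P B \<in> \<int>" "height P \<noteq> 0" "card (integral_hull P) \<ge> n"
proof -
  \<comment> \<open>\<open>D + 1\<close> is the square of the even number \<open>9 ^ n + 1\<close>,
    which makes the apex distance \<open>a = (9 ^ n + 1) / 2\<close> integral.\<close>
  define D :: int where "D = 9 ^ n * (9 ^ n + 2)"
  \<comment> \<open>For \<open>i \<le> 2 * n\<close> this is the cofactor of \<open>3 ^ i\<close> in
    \<open>D\<close>, because \<open>9 ^ n\<close> is \<open>3 ^ (2 * n)\<close>.\<close>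
  define v :: "nat \<Rightarrow> int" where "v i = 3 ^ (2 * n - i) * (9 ^ n + 2)" for i
  define c where "c i = (3 ^ i + v i) div 4" for i
  have D: "3 ^ i * v i = D" if "i \<le> 2 * n" for i
  proof -
    have "(3::int) ^ i * 3 ^ (2 * n - i) = 9 ^ n"
      using that by (simp add: power_add[symmetric] power_mult)
    then show ?thesis by (simp add: v_def D_def mult.assoc[symmetric])
  qed
  have "(9::int) ^ n mod 4 = 1" using power_mod[of "9::int" 4 n] by simp
  then obtain q where q: "(9::int) ^ n = 4 * q + 1"
    by (metis mult_div_mod_eq)
  have "D = 4 * (4 * (q * q) + 4 * q) + 3" unfolding D_def q by (simp add: algebra_simps)
  then have "D mod 4 = 3" by presburger
  then have c: "3 ^ i + v i = 4 * c i" if "i \<le> 2 * n" for i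
    unfolding c_def using four_dvd_add_if_mult_mod_4[of "3 ^ i" "v i"] D[OF that] by simp
  have "D > 0" by (simp add: D_def add_pos_pos)
  obtain P where P: "along P = 0" "height P = sqrt (of_int D / 4)" using point_exists .
  then have hP: "(height P)\<^sup>2 = of_int D / 4" "height P \<noteq> 0" using \<open>D > 0\<close> by simp_all
  have end_dist: "dist P A = (9 ^ n + 1) / 2" "dist P B = (9 ^ n + 1) / 2"
  proof -
    have "1/4 + of_int D / 4 = (((9::real) ^ n + 1) / 2)\<^sup>2"
      by (simp add: D_def power2_eq_square field_simps)
    then have "sqrt (1/4 + of_int D / 4) = ((9::real) ^ n + 1) / 2"
      by (simp only: real_sqrt_abs) simp
    then show "dist P A = (9 ^ n + 1) / 2" "dist P B = (9 ^ n + 1) / 2"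
      using hP P by (simp_all add: dist_eq power2_eq_square)
  qed
  have "even ((9::int) ^ n + 1)" by simp
  then obtain a where "(9::int) ^ n + 1 = 2 * a" by blast
  then have "(9 ^ n + 1) / 2 = (of_int a :: real)"
    by (metis nonzero_mult_div_cancel_left of_int_1 of_int_add of_int_mult of_int_numeral of_int_power zero_neq_numeral)
  then have ends: "dist P A \<in> \<int>" "dist P B \<in> \<int>" using end_dist by simp_all
  \<comment> \<open>With \<open>u = 3 ^ i\<close> the abscissa \<open>(v - u) / 4\<close> equals
    \<open>c - u / 2\<close>; as \<open>u\<close> is odd, this form shows that it is
    half-odd.\<close>
  have "\<exists>Q. along Q = of_int (c i) - 3 ^ i / 2 \<and> height Q = 0" for i using point_exists by metis
  then obtain Q where Q: "\<And>i. along (Q i) = of_int (c i) - 3 ^ i / 2" "\<And>i. height (Q i) = 0" by metis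
  have dQ: "dist (Q i) P = of_int (c i)" if "i \<le> 2 * n" for i
  proof -
    \<comment> \<open>Four times \<open>c\<^sup>2 - (c - u / 2)\<^sup>2\<close> is
      \<open>u * (4 * c - u) = u * v = D\<close>, which is four times the squared height of the
      apex.\<close>
    have "3 ^ i * (4 * of_int (c i) - 3 ^ i) = (of_int (3 ^ i * v i) :: real)"
      using c[OF that] by (metis add_diff_cancel_left' of_int_diff of_int_mult of_int_numeral of_int_power)
    then have "(along (Q i))\<^sup>2 + (height P)\<^sup>2 = (of_int (c i))\<^sup>2"
      unfolding hP D[OF that] Q by (simp add: power2_eq_square field_simps)
    moreover have "c i \<ge> 0" by (simp add: c_def v_def pos_imp_zdiv_nonneg_iff add_nonneg_nonneg)
    ultimately show ?thesis using Q P by (simp add: dist_eq)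
  qed
  have mem: "Q i \<in> integral_hull P" if "i \<le> 2 * n" for i
  proof (rule integral_hullI[OF ends hP(2) Q(2)])
    have "odd ((3::int) ^ i)" by simp
    then obtain m where m: "(3::int) ^ i = 2 * m + 1" by (elim oddE)
    have "(3::real) ^ i = of_int (3 ^ i)" by simp
    also have "\<dots> = 2 * of_int m + 1" unfolding m by simp
    finally have "along (Q i) - 1/2 = of_int (c i - m - 1)" unfolding Q by (simp add: field_simps)
    then show "along (Q i) - 1/2 \<in> \<int>" by simp
    show "dist (Q i) P \<in> \<int>" using dQ[OF that] by simp
  qed
  have "inj_on Q {..2 * n}"
  proof (rule inj_onI)
    fix i j assume ij: "i \<in> {..2 * n}" "j \<in> {..2 * n}" "Q i = Q j"
    then have "of_int (c i) = (of_int (c j) :: real)" using dQ by (metis atMost_iff)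
    moreover have "along (Q i) = along (Q j)" using ij by simp
    \<comment> \<open>Equal points have equal distances \<open>c\<close> to the apex and equal
      abscissae, hence equal subtracted terms \<open>3 ^ i / 2\<close>.\<close>
    ultimately have "(3::real) ^ i = 3 ^ j" unfolding Q by simp
    then show "i = j" by simp
  qed
  then have "card {..2 * n} \<le> card (integral_hull P)"
    using mem finite_integral_hull[OF ends hP(2)] by (intro card_inj_on_le) auto
  then show ?thesis using that[OF ends hP(2)] by simp
qed

text \<open>Every set between the triangle \<open>{A, B, P}\<close> and a large hull qualifies, so
  all sizes from 3 upwards occur.\<close>

lemma planar_integral_point_set_exists:
  assumes "n \<ge> 3"
  obtains M where "planar_integral_point_set M" "card M = n" "A \<in> M" "B \<in> M"
proof -
  obtain P where P: "dist P A \<in> \<int>" "dist P B \<in> \<int>" "height P \<noteq> 0" and n: "card (integral_hull P) \<ge> n"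
    using large_integral_hull .
  have "card {A, B, P} \<le> n" using assms by (simp add: card_insert_if)
  then obtain M where M: "{A, B, P} \<subseteq> M" "M \<subseteq> integral_hull P" "card M = n"
    using exists_subset_between[of "{A, B, P}" n "integral_hull P"] n integral_hull_members[OF P]
      finite_integral_hull[OF P] by auto
  have "\<not> collinear M" using collinear_height[of M P] M P by auto
  then have "planar_integral_point_set M"
    using planar_integral_point_set_subset planar_integral_point_set_integral_hull[OF P] M by blast
  then show ?thesis using that M by blast
qed

end

section \<open>Structure of a set with a unit distance, and uniqueness of that distance\<close>

lemma unit_segment_structure:
  assumes M: "planar_integral_point_set M" "A \<in> M" "B \<in> M" and AB: "dist A B = 1"
  obtains L P where "straight_line L" "A \<in> L" "B \<in> L" "card (M \<inter> L) = card M - 1" "M - L = {P}"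
    "P \<in> perpendicular_bisector A B"
proof -
  interpret unit_segment A B by standard (rule AB)
  obtain P where P: "P \<in> M" "height P \<noteq> 0" "dist P A \<in> \<int>" "dist P B \<in> \<int>"
    using apex_exists[OF M] .
  have off: "M - base_line = {P}" using off_line_singleton[OF M P(1,2)] .
  have "M \<inter> base_line = M - {P}" using off by blast
  then have "card (M \<inter> base_line) = card M - 1" using P by simp
  moreover have "P \<in> perpendicular_bisector A B"
    using along_apex P by (simp add: perpendicular_bisector_eq)
  ultimately show ?thesis
    using that[OF straight_line_base_line _ _ _ off] by (simp add: base_line_def)
qed

text \<open>The coordinates of both unit segments are compared. The apex \<open>P\<close> over
  \<open>AB\<close> is no end of \<open>XY\<close>, so \<open>XY\<close> lies on the line
  \<open>AB\<close> and \<open>P\<close> is on its bisector too; both segments then have the same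
  midpoint.\<close>

lemma unit_distance_unique:
  assumes M: "planar_integral_point_set M" "A \<in> M" "B \<in> M" and AB: "dist A B = 1"
    and card: "card M > 3" and X: "X \<in> M" "Y \<in> M" "dist X Y = 1"
  shows "{X, Y} = {A, B}"
proof -
  interpret ab: unit_segment A B by standard (rule AB)
  interpret xy: unit_segment X Y by standard (rule X(3))
  obtain P where P: "P \<in> M" "ab.height P \<noteq> 0" "dist P A \<in> \<int>" "dist P B \<in> \<int>"
    using ab.apex_exists[OF M] .
  have off: "M - ab.base_line = {P}" using ab.off_line_singleton[OF M P(1,2)] .
  obtain R where R: "R \<in> M" "xy.height R \<noteq> 0" "dist R X \<in> \<int>" "dist R Y \<in> \<int>"
    using xy.apex_exists[OF M(1) X(1,2)] .
  have offR: "M - xy.base_line = {R}" using xy.off_line_singleton[OF M(1) X(1,2) R(1,2)] .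
  have collinear_mem: "W \<in> ab.base_line"
    if "U \<in> ab.base_line" "V \<in> ab.base_line" "U \<noteq> V" "collinear {U, V, W}" for U V W
  proof -
    have "W \<in> affine hull {U, V}" using that collinear_3_affine_hull by blast
    moreover have "affine hull {U, V} \<subseteq> ab.base_line"
      using that ab.straight_line_base_line by (intro hull_minimal) (auto simp: straight_line_def)
    ultimately show ?thesis by blast
  qed
  have collinear_XY: "collinear {X, Y, W}" if "W \<in> xy.base_line" for W
    using that by (intro collinear_subset[OF xy.collinear_base_line]) (simp add: xy.base_line_def)
  have "X \<noteq> Y" using X by auto
  have PoffL: "P \<notin> ab.base_line" using P by (simp add: ab.base_line_def)
  \<comment> \<open>A fourth point \<open>Z\<close>, available since \<open>card M > 3\<close>,
    would lie on the line \<open>XY\<close>; together with the other end \<open>V\<close> it would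
    force \<open>P\<close> onto the line \<open>AB\<close>.\<close>
  have no_end: False if "{X, Y} = {P, V}" for V
  proof -
    have V: "V \<in> M" "V \<noteq> P" using that X \<open>X \<noteq> Y\<close> by (auto simp: doubleton_eq_iff)
    have "card {P, V, R} \<le> 3" by (simp add: card_insert_if)
    then have "\<not> M \<subseteq> {P, V, R}" using card card_mono[of "{P, V, R}" M] by auto
    then obtain Z where Z: "Z \<in> M" "Z \<noteq> P" "Z \<noteq> V" "Z \<noteq> R" by blast
    then have "Z \<in> xy.base_line" using offR by blast
    then have "collinear {X, Y, Z}" by (rule collinear_XY)
    moreover have "{X, Y, Z} = {V, Z, P}" using that by blast
    ultimately have "collinear {V, Z, P}" by simp
    moreover have "V \<in> ab.base_line" "Z \<in> ab.base_line" using off V Z by blast+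
    ultimately show False using collinear_mem Z PoffL by blast
  qed
  then have "X \<noteq> P" "Y \<noteq> P" by (blast, metis insert_commute)
  then have line: "X \<in> ab.base_line" "Y \<in> ab.base_line" using off X by blast+
  have "P \<notin> xy.base_line" using collinear_mem[OF line \<open>X \<noteq> Y\<close>] collinear_XY PoffL by blast
  \<comment> \<open>The dichotomy for integral distances, now applied to the segment
    \<open>XY\<close>.\<close>
  then have "xy.along P = 0" using xy.integral_cases[of P] P(1) X M(1)
    by (auto simp: planar_integral_point_set_def xy.base_line_def)
  then have "(dist P X)\<^sup>2 = (dist P Y)\<^sup>2" by (simp add: xy.dist_sq)
  moreover have "ab.height X = 0" "ab.height Y = 0" using line by (auto simp: ab.base_line_def)
  moreover note ab.along_apex[OF P(3,4,2)]
  ultimately have "(ab.along X)\<^sup>2 = (ab.along Y)\<^sup>2" by (simp add: ab.dist_sq)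
  \<comment> \<open>Abscissae with equal squares at distance 1 can only be -1/2 and 1/2, those of
    \<open>A\<close> and \<open>B\<close>.\<close>
  moreover have "\<bar>ab.along X - ab.along Y\<bar> = 1"
    using X(3) \<open>ab.height X = 0\<close> \<open>ab.height Y = 0\<close> by (simp add: ab.dist_eq)
  ultimately have "ab.along X = -1/2 \<and> ab.along Y = 1/2 \<or> ab.along X = 1/2 \<and> ab.along Y = -1/2"
    unfolding power2_eq_iff by linarith
  then show ?thesis
    using ab.point_eqI[of X A] ab.point_eqI[of X B] ab.point_eqI[of Y A] ab.point_eqI[of Y B]
      \<open>ab.height X = 0\<close> \<open>ab.height Y = 0\<close> by auto
qed

theorem theorem5:
  "(\<forall>n\<ge>3. \<exists>M M\<^sub>1 M\<^sub>2.
      planar_integral_point_set M \<and> card M = n \<and>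
      M\<^sub>1 \<in> M \<and> M\<^sub>2 \<in> M \<and> dist M\<^sub>1 M\<^sub>2 = 1 \<and>
      (\<exists>L P. straight_line L \<and> M\<^sub>1 \<in> L \<and> M\<^sub>2 \<in> L \<and>
             card (M \<inter> L) = n - 1 \<and> M - L = {P}))
   \<and>
   (\<forall>n M M\<^sub>1 M\<^sub>2.
      planar_integral_point_set M \<and> card M = n \<and>
      M\<^sub>1 \<in> M \<and> M\<^sub>2 \<in> M \<and> dist M\<^sub>1 M\<^sub>2 = 1 \<longrightarrow>
      (\<exists>L P. straight_line L \<and> M\<^sub>1 \<in> L \<and> M\<^sub>2 \<in> L \<and>
             card (M \<inter> L) = n - 1 \<and> M - L = {P} \<and>
             P \<in> perpendicular_bisector M\<^sub>1 M\<^sub>2) \<and>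
      (\<exists>!M'. maximal_planar_integral_point_set M' \<and> M \<subseteq> M') \<and>
      (\<forall>M'. maximal_planar_integral_point_set M' \<and> M \<subseteq> M' \<longrightarrow>
             axis_of_symmetry (perpendicular_bisector M\<^sub>1 M\<^sub>2) M') \<and>
      (n > 3 \<longrightarrow>
         (\<forall>X\<in>M. \<forall>Y\<in>M. dist X Y = 1 \<longrightarrow> {X, Y} = {M\<^sub>1, M\<^sub>2}) \<and>
         (\<forall>M'. maximal_planar_integral_point_set M' \<and> M \<subseteq> M' \<longrightarrow>
             (\<forall>X\<in>M'. \<forall>Y\<in>M'. dist X Y = 1 \<longrightarrow> {X, Y} = {M\<^sub>1, M\<^sub>2}))))"
proof (intro conjI allI impI)
  fix n :: nat
  assume "n \<ge> 3"
  define A B :: "real ^ 2" where "A = 0" and "B = axis 1 1"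
  have AB: "dist A B = 1" by (simp add: A_def B_def)
  then interpret unit_segment A B by unfold_locales
  obtain M where M: "planar_integral_point_set M" "card M = n" "A \<in> M" "B \<in> M"
    using planar_integral_point_set_exists[OF \<open>n \<ge> 3\<close>] .
  then show "\<exists>M M\<^sub>1 M\<^sub>2.
      planar_integral_point_set M \<and> card M = n \<and>
      M\<^sub>1 \<in> M \<and> M\<^sub>2 \<in> M \<and> dist M\<^sub>1 M\<^sub>2 = 1 \<and>
      (\<exists>L P. straight_line L \<and> M\<^sub>1 \<in> L \<and> M\<^sub>2 \<in> L \<and> card (M \<inter> L) = n - 1 \<and> M - L = {P})"
    using unit_segment_structure[OF M(1,3,4) AB] AB by metis
next
  fix n M and A B :: "real ^ 2"
  assume *: "planar_integral_point_set M \<and> card M = n \<and> A \<in> M \<and> B \<in> M \<and> dist A B = 1"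
  then have M: "planar_integral_point_set M" "A \<in> M" "B \<in> M" and AB: "dist A B = 1" by auto
  interpret unit_segment A B by standard (rule AB)
  obtain P where P: "P \<in> M" "height P \<noteq> 0" "dist P A \<in> \<int>" "dist P B \<in> \<int>"
    using apex_exists[OF M] .
  \<comment> \<open>Being maximal above \<open>M\<close> becomes an equation with the hull, which
    settles uniqueness and symmetry at once.\<close>
  note maximal_iff = maximal_planar_integral_point_set_iff[OF P(3,4,2) M P(1)]
  show "\<exists>L P. straight_line L \<and> A \<in> L \<and> B \<in> L \<and> card (M \<inter> L) = n - 1 \<and> M - L = {P} \<and>
      P \<in> perpendicular_bisector A B"
    using unit_segment_structure[OF M AB] * by metis
  show "\<exists>!M'. maximal_planar_integral_point_set M' \<and> M \<subseteq> M'"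
    unfolding maximal_iff by simp
  show "axis_of_symmetry (perpendicular_bisector A B) M'"
    if "maximal_planar_integral_point_set M' \<and> M \<subseteq> M'" for M'
    using that axis_of_symmetry_integral_hull[OF P(3,4,2)] unfolding maximal_iff by simp
  assume "n > 3"
  then have card: "card M > 3" using * by simp
  show "\<forall>X\<in>M. \<forall>Y\<in>M. dist X Y = 1 \<longrightarrow> {X, Y} = {A, B}"
    using unit_distance_unique[OF M AB card] by blast
  fix M' assume M': "maximal_planar_integral_point_set M' \<and> M \<subseteq> M'"
  \<comment> \<open>The larger set also contains the unit segment and has more than three points, so
    the uniqueness result applies to it directly.\<close>
  then have ips: "planar_integral_point_set M'" by (simp add: maximal_planar_integral_point_set_def)
  then have "card M' > 3"
    using M' card card_mono[of M' M] by (simp add: planar_integral_point_set_def)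
  then show "\<forall>X\<in>M'. \<forall>Y\<in>M'. dist X Y = 1 \<longrightarrow> {X, Y} = {A, B}"
    using unit_distance_unique[OF ips _ _ AB] M M' by blast
qed

end
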